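(* Every inverse double semigroup $(S,*_h,*_v)$ is commutative: for all $a,b\in S$, $a *_h b = b *_h a$ and $a *_v b = b *_v a$.
   Context: A double semigroup is a set $S$ equipped with two associative binary operations $*_h$ and $*_v$, not assumed to have units, satisfying the interchange law $(x *_h y) *_v (z *_h w) = (x *_v z) *_h (y *_v w)$ for all $x,y,z,w\in S$. In a semigroup, two elements $x$ and $y$ are inverse to each other if $xyx=x$ and $yxy=y$; an inverse semigroup is a semigroup in which every element has a unique inverse. An inverse double semigroup is a double semigroup such that both $(S,*_h)$ and $(S,*_v)$ are inverse semigroups. *)

theory Defs
  imports Main
begin

text \<open>
  A semigroup on an arbitrary (possibly empty) carrier set \<open>S\<close>; outside \<open>S\<close> the operation is
  unconstrained. For \<open>S = UNIV\<close> this is the library locale \<^locale>\<open>semigroup\<close>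
  (lemma \<open>semigroup_on_UNIV\<close> below).
\<close>

locale semigroup_on =
  fixes S :: "'a set" and f :: "'a \<Rightarrow> 'a \<Rightarrow> 'a"  (infixl "\<cdot>" 70)
  assumes closed: "\<lbrakk>x \<in> S; y \<in> S\<rbrakk> \<Longrightarrow> x \<cdot> y \<in> S"
    and assoc: "\<lbrakk>x \<in> S; y \<in> S; z \<in> S\<rbrakk> \<Longrightarrow> (x \<cdot> y) \<cdot> z = x \<cdot> (y \<cdot> z)"

lemma semigroup_on_UNIV: "semigroup_on UNIV f \<longleftrightarrow> semigroup f"
  by (simp add: semigroup_on_def semigroup_def)

definition mutually_inverse :: "('a \<Rightarrow> 'a \<Rightarrow> 'a) \<Rightarrow> 'a \<Rightarrow> 'a \<Rightarrow> bool" where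
  "mutually_inverse f x y \<longleftrightarrow> f (f x y) x = x \<and> f (f y x) y = y"

locale inverse_semigroup_on = semigroup_on +
  assumes unique_inverse: "x \<in> S \<Longrightarrow> \<exists>!y. y \<in> S \<and> mutually_inverse f x y"

locale double_semigroup =
  h: semigroup_on S h + v: semigroup_on S v
  for S :: "'a set"
    and h :: "'a \<Rightarrow> 'a \<Rightarrow> 'a"  (infixl "*\<^sub>h" 70)
    and v :: "'a \<Rightarrow> 'a \<Rightarrow> 'a"  (infixl "*\<^sub>v" 70) +
  assumes interchange:
    "\<lbrakk>x \<in> S; y \<in> S; z \<in> S; w \<in> S\<rbrakk>
      \<Longrightarrow> (x *\<^sub>h y) *\<^sub>v (z *\<^sub>h w) = (x *\<^sub>v z) *\<^sub>h (y *\<^sub>v w)"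

locale inverse_double_semigroup =
  double_semigroup S h v + h: inverse_semigroup_on S h + v: inverse_semigroup_on S v
  for S :: "'a set"
    and h :: "'a \<Rightarrow> 'a \<Rightarrow> 'a"  (infixl "*\<^sub>h" 70)
    and v :: "'a \<Rightarrow> 'a \<Rightarrow> 'a"  (infixl "*\<^sub>v" 70)

end

theory Submission
  imports Defs
begin

text \<open>
  By interchange each operation is a homomorphism for the other, so taking \<open>v\<close>-inverses preserves
  \<open>h\<close>-products. Inside the \<open>h\<close>-idempotents, where \<open>h\<close> is a semilattice operation, this forces every
  element to be a \<open>v\<close>-idempotent; hence both operations have the same idempotents, and they agree
  there by the Eckmann--Hilton argument. Comparing the source and range idempotents of an element
  for both operations shows that all four coincide, so each element has a two-sided idempotent
  unit common to \<open>h\<close> and \<open>v\<close>. Inserting these units gives \<open>h = v\<close>; interchange then becomes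
  the medial law, which yields commutativity.
\<close>

section \<open>Idempotents of a single inverse semigroup\<close>

context inverse_semigroup_on
begin

lemma inverse_exists:
  assumes "x \<in> S"
  obtains y where "y \<in> S" "x \<cdot> y \<cdot> x = x" "y \<cdot> x \<cdot> y = y"
  using unique_inverse[OF assms] by (auto simp: mutually_inverse_def)

lemma inverse_unique:
  assumes "x \<in> S" "y \<in> S" "z \<in> S"
    and "x \<cdot> y \<cdot> x = x" "y \<cdot> x \<cdot> y = y" "x \<cdot> z \<cdot> x = x" "z \<cdot> x \<cdot> z = z"
  shows "y = z"
  using unique_inverse[OF assms(1)] assms by (auto simp: mutually_inverse_def)

lemma left_idem: "\<lbrakk>x \<in> S; y \<in> S; x \<cdot> x = x\<rbrakk> \<Longrightarrow> x \<cdot> (x \<cdot> y) = x \<cdot> y"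
  by (metis assoc)

text \<open>If \<open>x\<close> is the inverse of \<open>e \<cdot> g\<close>, then so is the
  idempotent \<open>g \<cdot> x \<cdot> e\<close>; uniqueness makes \<open>x\<close>
  idempotent.\<close>

lemma idem_mult:
  assumes e: "e \<in> S" "e \<cdot> e = e" and g: "g \<in> S" "g \<cdot> g = g"
  shows "(e \<cdot> g) \<cdot> (e \<cdot> g) = e \<cdot> g"
proof -
  obtain x where x: "x \<in> S" "(e \<cdot> g) \<cdot> x \<cdot> (e \<cdot> g) = e \<cdot> g" "x \<cdot> (e \<cdot> g) \<cdot> x = x"
    using inverse_exists[of "e \<cdot> g"] e g closed by blast
  have x2: "e \<cdot> (g \<cdot> (x \<cdot> (e \<cdot> g))) = e \<cdot> g" and x3: "x \<cdot> (e \<cdot> (g \<cdot> x)) = x"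
    using x e g by (simp_all add: assoc closed)
  have x3': "x \<cdot> (e \<cdot> (g \<cdot> (x \<cdot> w))) = x \<cdot> w" if "w \<in> S" for w
    using x3 that x(1) e g by (metis assoc closed)
  let ?y = "g \<cdot> x \<cdot> e"
  have "x = ?y"
    by (rule inverse_unique[of "e \<cdot> g"])
      (use x x2 x3' e g in \<open>simp_all add: assoc closed left_idem\<close>)
  moreover have "?y \<cdot> ?y = ?y"
    using x3' x e g by (simp add: assoc closed left_idem)
  ultimately have xx: "x \<cdot> x = x" by simp
  \<comment> \<open>An idempotent is its own inverse, so \<open>x\<close> and
    \<open>e \<cdot> g\<close> are both inverses of \<open>x\<close>.\<close>
  have "x = e \<cdot> g"
    by (rule inverse_unique[of x]) (use x xx e g closed in auto)
  with xx show ?thesis by simp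
qed

text \<open>Both products are inverses of \<open>e \<cdot> g\<close>, because
  \<open>idem_mult\<close> makes them idempotent.\<close>

lemma idem_commute:
  assumes e: "e \<in> S" "e \<cdot> e = e" and g: "g \<in> S" "g \<cdot> g = g"
  shows "e \<cdot> g = g \<cdot> e"
proof (rule inverse_unique[of "e \<cdot> g"])
  have eg: "e \<cdot> (g \<cdot> (e \<cdot> g)) = e \<cdot> g" and ge: "g \<cdot> (e \<cdot> (g \<cdot> e)) = g \<cdot> e"
    using idem_mult[OF e g] idem_mult[OF g e] e g by (simp_all add: assoc closed)
  show "e \<cdot> g \<cdot> (e \<cdot> g) \<cdot> (e \<cdot> g) = e \<cdot> g"
    "e \<cdot> g \<cdot> (e \<cdot> g) \<cdot> (e \<cdot> g) = e \<cdot> g"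
    by (simp_all add: idem_mult e g)
  show "e \<cdot> g \<cdot> (g \<cdot> e) \<cdot> (e \<cdot> g) = e \<cdot> g" "g \<cdot> e \<cdot> (e \<cdot> g) \<cdot> (g \<cdot> e) = g \<cdot> e"
    using e g eg ge by (simp_all add: assoc closed left_idem)
qed (use e g closed in auto)

lemma opposite: "inverse_semigroup_on S (\<lambda>x y. y \<cdot> x)"
proof
  show "\<exists>!y. y \<in> S \<and> mutually_inverse (\<lambda>x y. y \<cdot> x) x y" if "x \<in> S" for x
  proof -
    have "mutually_inverse (\<lambda>x y. y \<cdot> x) x y \<longleftrightarrow> mutually_inverse (\<cdot>) x y" if "y \<in> S" for y
      using \<open>x \<in> S\<close> that by (simp add: mutually_inverse_def assoc)
    then show ?thesis using unique_inverse[OF that] by (simp cong: conj_cong)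
  qed
qed (simp_all add: closed assoc)

end

section \<open>Symmetries and common idempotents of the two operations\<close>

context inverse_double_semigroup
begin

lemma swap: "inverse_double_semigroup S v h"
  by unfold_locales (simp add: interchange)

text \<open>Interchange survives reversing one operation. With \<open>swap\<close>, this yields the
  dual forms of later lemmas, exchanging ranges with sources.\<close>

lemma v_opposite: "inverse_double_semigroup S h (\<lambda>x y. v y x)"
proof -
  interpret o: inverse_semigroup_on S "\<lambda>x y. v y x" by (rule v.opposite)
  show ?thesis by unfold_locales (simp add: interchange)
qed

text \<open>By interchange \<open>h\<close>-squaring is an endomorphism for \<open>v\<close>, so
  \<open>b *\<^sub>h b\<close> is a \<open>v\<close>-inverse of
  \<open>a *\<^sub>h a = a\<close>.\<close>

lemma v_inverse_h_idem:
  assumes "a \<in> S" "b \<in> S" "a *\<^sub>h a = a" "a *\<^sub>v b *\<^sub>v a = a" "b *\<^sub>v a *\<^sub>v b = b"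
  shows "b *\<^sub>h b = b"
proof (rule v.inverse_unique[of a])
  have "(a *\<^sub>h a) *\<^sub>v (b *\<^sub>h b) *\<^sub>v (a *\<^sub>h a) = a"
    using assms by (metis interchange v.closed)
  then show "a *\<^sub>v (b *\<^sub>h b) *\<^sub>v a = a" using assms by simp
  have "(b *\<^sub>h b) *\<^sub>v (a *\<^sub>h a) *\<^sub>v (b *\<^sub>h b) = b *\<^sub>h b"
    using assms by (metis interchange v.closed)
  then show "(b *\<^sub>h b) *\<^sub>v a *\<^sub>v (b *\<^sub>h b) = b *\<^sub>h b" using assms by simp
qed (use assms h.closed in auto)

text \<open>Eckmann--Hilton with idempotence in place of units:
  \<open>(e *\<^sub>h f) *\<^sub>v (f *\<^sub>h e)\<close> collapses to either product, since
  idempotents commute.\<close>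

lemma h_idem_eq_on_idem:
  assumes "e \<in> S" "f \<in> S" "e *\<^sub>h e = e" "f *\<^sub>h f = f" "e *\<^sub>v e = e" "f *\<^sub>v f = f"
  shows "e *\<^sub>h f = e *\<^sub>v f"
proof -
  have "e *\<^sub>h f = (e *\<^sub>h f) *\<^sub>v (f *\<^sub>h e)"
    using assms v.idem_mult h.idem_commute interchange by metis
  also have "\<dots> = (e *\<^sub>v f) *\<^sub>h (e *\<^sub>v f)"
    using assms by (simp add: interchange v.idem_commute)
  also have "\<dots> = e *\<^sub>v f"
    using assms by (metis interchange)
  finally show ?thesis .
qed

text \<open>
  The product \<open>p = a *\<^sub>h e\<close> has range idempotent \<open>e *\<^sub>v f \<le> e\<close>, so \<open>p *\<^sub>v e = p = e *\<^sub>v p\<close>, and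
  interchange turns \<open>p *\<^sub>v p\<close> into \<open>p *\<^sub>h p = p\<close>.
\<close>

lemma h_idem_mult_v_range:
  assumes a: "a \<in> S" "a *\<^sub>h a = a" and b: "b \<in> S" "a *\<^sub>v b *\<^sub>v a = a" "b *\<^sub>v a *\<^sub>v b = b"
  shows "a *\<^sub>h (a *\<^sub>v b) = a *\<^sub>v b"
proof -
  define e f p where "e = a *\<^sub>v b" and "f = b *\<^sub>v a" and "p = a *\<^sub>h e"
  have bb: "b *\<^sub>h b = b" by (rule v_inverse_h_idem) (use a b in auto)
  have S: "e \<in> S" "f \<in> S" "p \<in> S"
    using a b by (auto simp: e_def f_def p_def h.closed v.closed)
  have v: "e *\<^sub>v e = e" "f *\<^sub>v f = f" "e *\<^sub>v a = a" "a *\<^sub>v f = a"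
    unfolding e_def f_def using a b by (metis v.assoc v.closed)+
  have h: "e *\<^sub>h e = e" "f *\<^sub>h f = f"
    unfolding e_def f_def using a b bb by (metis interchange)+
  have "p *\<^sub>v (f *\<^sub>h e) = p"
    unfolding p_def using a S v by (simp add: interchange)
  moreover have "(f *\<^sub>h e) *\<^sub>v e = f *\<^sub>h e"
    using S v h by (simp add: h_idem_eq_on_idem v.assoc)
  ultimately have pe: "p *\<^sub>v e = p"
    using S by (metis v.assoc h.closed)
  have ep: "e *\<^sub>v p = p"
    unfolding p_def using a S v h by (metis interchange)
  have ph: "p *\<^sub>h e = p" "e *\<^sub>h p = p" "p *\<^sub>h p = p"
    unfolding p_def using a S h h.idem_commute[of a e]
    by (metis h.assoc h.closed)+
  have pp: "p *\<^sub>v p = p"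
    using interchange[of p e e p] S pe ep ph by simp
  \<comment> \<open>Thus \<open>e\<close> is a right \<open>v\<close>-multiple of the
    \<open>v\<close>-idempotent \<open>p\<close>, so \<open>p\<close> fixes it from the left;
    comparing with \<open>pe\<close> gives \<open>p = e\<close>.\<close>
  have "p *\<^sub>v (b *\<^sub>h e) = e"
    unfolding p_def using a b S v h by (simp add: interchange e_def)
  then have "p *\<^sub>v e = e"
    using pp S b by (metis v.assoc h.closed)
  with pe show ?thesis by (simp add: p_def e_def)
qed

text \<open>The previous lemma and its dual let interchange write \<open>a\<close> as
  \<open>e *\<^sub>v f\<close>, a product of two \<open>v\<close>-idempotents.\<close>

lemma h_idem_imp_v_idem:
  assumes a: "a \<in> S" "a *\<^sub>h a = a"
  shows "a *\<^sub>v a = a"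
proof -
  obtain b where b: "b \<in> S" "a *\<^sub>v b *\<^sub>v a = a" "b *\<^sub>v a *\<^sub>v b = b"
    using v.inverse_exists a by blast
  define e f where "e = a *\<^sub>v b" and "f = b *\<^sub>v a"
  have bb: "b *\<^sub>h b = b" by (rule v_inverse_h_idem) (use a b in auto)
  have S: "e \<in> S" "f \<in> S"
    using a b by (auto simp: e_def f_def v.closed)
  have v: "e *\<^sub>v e = e" "f *\<^sub>v f = f" "e *\<^sub>v a = a" "a *\<^sub>v f = a"
    unfolding e_def f_def using a b by (metis v.assoc v.closed)+
  have h: "e *\<^sub>h e = e"
    unfolding e_def using a b bb by (metis interchange)
  interpret o: inverse_double_semigroup S h "\<lambda>x y. v y x" by (rule v_opposite)
  have ae: "a *\<^sub>h e = e"
    unfolding e_def by (rule h_idem_mult_v_range) (use a b in auto)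
  have af: "a *\<^sub>h f = f"
    unfolding f_def by (rule o.h_idem_mult_v_range) (use a b in \<open>auto simp: v.assoc\<close>)
  have "a = (e *\<^sub>v a) *\<^sub>h (a *\<^sub>v f)" using v a by simp
  also have "\<dots> = (e *\<^sub>h a) *\<^sub>v (a *\<^sub>h f)" using a S by (simp add: interchange)
  also have "\<dots> = e *\<^sub>v f" using ae af a S h h.idem_commute[of a e] by simp
  finally show ?thesis using v.idem_mult[of e f] S v by simp
qed

lemma idem_iff: "a \<in> S \<Longrightarrow> a *\<^sub>h a = a \<longleftrightarrow> a *\<^sub>v a = a"
  using h_idem_imp_v_idem inverse_double_semigroup.h_idem_imp_v_idem[OF swap] by blast

section \<open>A common two-sided unit for each element\<close>

text \<open>
  Here \<open>e \<le> x\<close> means \<open>x *\<^sub>v e = e\<close>, where \<open>e = a *\<^sub>v b\<close> is the least idempotent fixing \<open>a\<close>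
  from the left.
\<close>

lemma v_range_le:
  assumes a: "a \<in> S" and b: "b \<in> S" "a *\<^sub>v b *\<^sub>v a = a"
    and x: "x \<in> S" "x *\<^sub>h x = x" "x *\<^sub>h a = a \<or> a *\<^sub>h x = a"
  shows "x *\<^sub>v (a *\<^sub>v b) = a *\<^sub>v b"
proof -
  define e where "e = a *\<^sub>v b"
  have S: "e \<in> S" using a b by (simp add: e_def v.closed)
  have e: "e *\<^sub>v e = e" "e *\<^sub>v a = a"
    unfolding e_def using a b by (metis v.assoc v.closed)+
  have eh: "e *\<^sub>h e = e" using e S idem_iff by simp
  have xv: "x *\<^sub>v x = x" using x idem_iff by simp
  have xe: "x *\<^sub>h e = x *\<^sub>v e" "e *\<^sub>h x = x *\<^sub>v e"
    using x S e eh xv h_idem_eq_on_idem h.idem_commute by metis+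
  from x(3) have "(x *\<^sub>v e) *\<^sub>v a = a"
  proof
    assume *: "x *\<^sub>h a = a"
    have "(x *\<^sub>h e) *\<^sub>v (x *\<^sub>h a) = x *\<^sub>h a"
      using interchange[of x e x a] a x S e xv by simp
    with * xe show ?thesis by simp
  next
    assume *: "a *\<^sub>h x = a"
    have "(e *\<^sub>h x) *\<^sub>v (a *\<^sub>h x) = a *\<^sub>h x"
      using interchange[of e x a x] a x S e xv by simp
    with * xe show ?thesis by simp
  qed
  then have "(x *\<^sub>v e) *\<^sub>v e = e"
    unfolding e_def using a b x by (metis v.assoc v.closed)
  then show ?thesis using S x e by (simp add: v.assoc e_def)
qed

lemma v_source_le:
  assumes a: "a \<in> S" and b: "b \<in> S" "a *\<^sub>v b *\<^sub>v a = a"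
    and x: "x \<in> S" "x *\<^sub>h x = x" "x *\<^sub>h a = a \<or> a *\<^sub>h x = a"
  shows "(b *\<^sub>v a) *\<^sub>v x = b *\<^sub>v a"
  by (rule inverse_double_semigroup.v_range_le[OF v_opposite])
    (use assms in \<open>auto simp: v.assoc\<close>)

text \<open>The \<open>v\<close>-range and \<open>v\<close>-source \<open>e\<close>,
  \<open>f\<close> lie below the \<open>h\<close>-range and \<open>h\<close>-source
  \<open>s\<close>, \<open>t\<close>, and above them after swapping the operations. Both operations
  agree on these idempotents, so the two orders coincide and antisymmetry identifies all
  four.\<close>

lemma common_unit:
  assumes a: "a \<in> S"
  obtains e where "e \<in> S" "e *\<^sub>v e = e" "e *\<^sub>h e = e"
    "e *\<^sub>h a = a" "a *\<^sub>h e = a" "e *\<^sub>v a = a" "a *\<^sub>v e = a"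
proof -
  obtain b where b: "b \<in> S" "a *\<^sub>v b *\<^sub>v a = a"
    using v.inverse_exists a by blast
  obtain c where c: "c \<in> S" "a *\<^sub>h c *\<^sub>h a = a"
    using h.inverse_exists a by blast
  define e f s t where "e = a *\<^sub>v b" and "f = b *\<^sub>v a" and "s = a *\<^sub>h c" and "t = c *\<^sub>h a"
  have S: "e \<in> S" "f \<in> S" "s \<in> S" "t \<in> S"
    using a b c by (auto simp: e_def f_def s_def t_def h.closed v.closed)
  have v: "e *\<^sub>v e = e" "f *\<^sub>v f = f" "e *\<^sub>v a = a" "a *\<^sub>v f = a"
    unfolding e_def f_def using a b by (metis v.assoc v.closed)+
  have h: "s *\<^sub>h s = s" "t *\<^sub>h t = t" "s *\<^sub>h a = a" "a *\<^sub>h t = a"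
    unfolding s_def t_def using a c by (metis h.assoc h.closed)+
  have vh: "e *\<^sub>h e = e" "f *\<^sub>h f = f" "s *\<^sub>v s = s" "t *\<^sub>v t = t"
    using v h S idem_iff by auto
  note range_le = v_range_le[OF a b, folded e_def] v_source_le[OF a b, folded f_def]
  interpret sw: inverse_double_semigroup S v h by (rule swap)
  note range_le' = sw.v_range_le[OF a c, folded s_def] sw.v_source_le[OF a c, folded t_def]
  have le: "s *\<^sub>v e = e" "t *\<^sub>v e = e" "f *\<^sub>v s = f" "f *\<^sub>v t = f"
    using range_le S h by blast+
  have le': "e *\<^sub>h s = s" "f *\<^sub>h s = s" "t *\<^sub>h e = t" "t *\<^sub>h f = t"
    using range_le' S v by blast+
  have comm: "x *\<^sub>h y = y *\<^sub>v x" if "x \<in> {e, f, s, t}" "y \<in> {e, f, s, t}" for x y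
    using that S v h vh h_idem_eq_on_idem[of x y] v.idem_commute[of x y] by auto
  have "s = e" "s = f" "t = e"
    using le le' comm[of e s] comm[of f s] comm[of t e] comm[of t f]
      v.idem_commute[of s f] v.idem_commute[of t e] S v vh by auto
  with that[of e] S v h vh show ?thesis by auto
qed

section \<open>Equality of the two operations\<close>

lemma h_idem_act_eq:
  assumes a: "a \<in> S" and f: "f \<in> S" "f *\<^sub>h f = f"
  shows "a *\<^sub>h f = a *\<^sub>v f"
proof -
  obtain e where e: "e \<in> S" "e *\<^sub>v e = e" "e *\<^sub>h e = e" "a *\<^sub>h e = a" "a *\<^sub>v e = a"
    using common_unit[OF a] by blast
  have fv: "f *\<^sub>v f = f" using f idem_iff by simp
  \<comment> \<open>The meet of \<open>f\<close> with a unit \<open>e\<close> of \<open>a\<close>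
    acts on \<open>a\<close> as \<open>f\<close> does. Lying below \<open>e\<close>, it satisfies
    \<open>e *\<^sub>h m = m *\<^sub>h m\<close> and \<open>m *\<^sub>v m = e *\<^sub>v m\<close>,
    which lets interchange be applied repeatedly.\<close>
  define m where "m = e *\<^sub>v f"
  have m: "m \<in> S" "m = e *\<^sub>h f"
    using e f fv h_idem_eq_on_idem by (auto simp: m_def v.closed)
  have m_idem: "m *\<^sub>v m = m" "m *\<^sub>h m = m"
    using e f fv m v.idem_mult[of e f] h.idem_mult[of e f] by (simp_all add: m_def)
  have em: "e *\<^sub>v m = m" "e *\<^sub>h m = m"
    using e f v.left_idem[of e f] h.left_idem[of e f] m(2) by (simp_all add: m_def)
  have "a *\<^sub>h f = a *\<^sub>h m" using a e f m(2) by (metis h.assoc)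
  also have "\<dots> = (a *\<^sub>h m) *\<^sub>v (e *\<^sub>h m)"
    using a e m m_idem interchange[of a m e m] by simp
  also have "\<dots> = (a *\<^sub>h m) *\<^sub>v (m *\<^sub>h m)" using em m_idem by simp
  also have "\<dots> = (a *\<^sub>v m) *\<^sub>h (m *\<^sub>v m)" using a m by (simp add: interchange)
  also have "\<dots> = (a *\<^sub>v m) *\<^sub>h (e *\<^sub>v m)" using em m_idem by simp
  also have "\<dots> = (a *\<^sub>h e) *\<^sub>v (m *\<^sub>h m)" using a m e interchange[of a e m m] by simp
  also have "\<dots> = a *\<^sub>v m" using e m_idem by simp
  also have "\<dots> = a *\<^sub>v f" using a e f by (simp add: m_def v.assoc[symmetric])
  finally show ?thesis .
qed

lemma opposite:
  "inverse_double_semigroup S (\<lambda>x y. h y x) (\<lambda>x y. v y x)"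
proof -
  have "inverse_double_semigroup S (\<lambda>x y. v y x) h"
    using v_opposite by (rule inverse_double_semigroup.swap)
  then have "inverse_double_semigroup S (\<lambda>x y. v y x) (\<lambda>x y. h y x)"
    by (rule inverse_double_semigroup.v_opposite)
  then show ?thesis by (rule inverse_double_semigroup.swap)
qed

text \<open>After inserting units, interchange leaves each unit acting on the other factor. These
  actions agree for \<open>h\<close> and \<open>v\<close>, and commuting \<open>f\<close> with
  \<open>e\<close> brings each unit back to its own element.\<close>

lemma h_eq_v:
  assumes a: "a \<in> S" and b: "b \<in> S"
  shows "a *\<^sub>h b = a *\<^sub>v b"
proof -
  interpret o: inverse_double_semigroup S "\<lambda>x y. h y x" "\<lambda>x y. v y x" by (rule opposite)
  obtain e where e: "e \<in> S" "e *\<^sub>v e = e" "e *\<^sub>h e = e" "a *\<^sub>v e = a"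
    using common_unit[OF a] by blast
  obtain f where f: "f \<in> S" "f *\<^sub>v f = f" "f *\<^sub>h f = f" "f *\<^sub>v b = b"
    using common_unit[OF b] by blast
  have "a *\<^sub>h b = (a *\<^sub>v e) *\<^sub>h (f *\<^sub>v b)" using e f by simp
  also have "\<dots> = (a *\<^sub>h f) *\<^sub>v (e *\<^sub>h b)" using a b e f by (simp add: interchange)
  also have "\<dots> = (a *\<^sub>v f) *\<^sub>v (e *\<^sub>v b)"
    using a b e f h_idem_act_eq[of a f] o.h_idem_act_eq[of b e] by simp
  also have "\<dots> = a *\<^sub>v (f *\<^sub>v e) *\<^sub>v b" using a b e(1) f(1) by (simp add: v.assoc v.closed)
  also have "\<dots> = a *\<^sub>v (e *\<^sub>v f) *\<^sub>v b" using e f v.idem_commute by metis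
  also have "\<dots> = (a *\<^sub>v e) *\<^sub>v (f *\<^sub>v b)" using a b e(1) f(1) by (simp add: v.assoc v.closed)
  also have "\<dots> = a *\<^sub>v b" using e f by simp
  finally show ?thesis .
qed

section \<open>Commutativity from the medial law\<close>

lemma v_medial:
  assumes "x \<in> S" "y \<in> S" "z \<in> S" "w \<in> S"
  shows "x *\<^sub>v (y *\<^sub>v (z *\<^sub>v w)) = x *\<^sub>v (z *\<^sub>v (y *\<^sub>v w))"
  using interchange[OF assms] assms by (simp add: h_eq_v v.closed v.assoc)

text \<open>The medial law between units relates the two products by outer factors \<open>e\<close>
  and \<open>f\<close>. Substituting one relation into the other shows that
  \<open>m = e *\<^sub>v f\<close> fixes \<open>b *\<^sub>v a\<close> on both sides; as
  \<open>m\<close> absorbs \<open>e\<close> and \<open>f\<close>, the outer factors vanish.\<close>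

lemma v_commute:
  assumes a: "a \<in> S" and b: "b \<in> S"
  shows "a *\<^sub>v b = b *\<^sub>v a"
proof -
  obtain e where e: "e \<in> S" "e *\<^sub>v e = e" "e *\<^sub>v a = a" "a *\<^sub>v e = a"
    using common_unit[OF a] by blast
  obtain f where f: "f \<in> S" "f *\<^sub>v f = f" "f *\<^sub>v b = b" "b *\<^sub>v f = b"
    using common_unit[OF b] by blast
  have ab: "a *\<^sub>v b = e *\<^sub>v (b *\<^sub>v a) *\<^sub>v f"
    using v_medial[of e a b f] a b e f by (simp add: v.assoc v.closed v.left_idem) (metis v.assoc)
  have ba: "b *\<^sub>v a = f *\<^sub>v (a *\<^sub>v b) *\<^sub>v e"
    using v_medial[of f b a e] a b e f by (simp add: v.assoc v.closed v.left_idem) (metis v.assoc)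
  define m where "m = e *\<^sub>v f"
  have m: "m \<in> S" "f *\<^sub>v e = m" "e *\<^sub>v m = m" "m *\<^sub>v f = m"
    using e f by (simp_all add: m_def v.closed v.left_idem v.assoc v.idem_commute)
  define c where "c = b *\<^sub>v a"
  have c: "c \<in> S" using a b by (simp add: c_def v.closed)
  have "c = f *\<^sub>v (e *\<^sub>v c *\<^sub>v f) *\<^sub>v e" using ba ab by (simp add: c_def)
  also have "\<dots> = (f *\<^sub>v e) *\<^sub>v c *\<^sub>v (f *\<^sub>v e)"
    using c e f by (simp add: v.assoc v.closed)
  finally have cm: "c = m *\<^sub>v c *\<^sub>v m" by (simp add: m(2))
  have "a *\<^sub>v b = e *\<^sub>v (m *\<^sub>v c *\<^sub>v m) *\<^sub>v f" using ab cm by (simp add: c_def)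
  also have "\<dots> = (e *\<^sub>v m) *\<^sub>v c *\<^sub>v (m *\<^sub>v f)"
    using c e f m(1) by (simp add: v.assoc v.closed)
  also have "\<dots> = b *\<^sub>v a" using m cm by (simp add: c_def)
  finally show ?thesis .
qed

end

theorem proposition2p8:
  fixes S :: "'a set" and h v :: "'a \<Rightarrow> 'a \<Rightarrow> 'a"
  assumes "inverse_double_semigroup S h v"
  shows "\<forall>a\<in>S. \<forall>b\<in>S. h a b = h b a \<and> v a b = v b a"
proof -
  interpret inverse_double_semigroup S h v by (rule assms)
  show ?thesis using h_eq_v v_commute by simp
qed

end
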